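(* Let $\mu\in\mathbb{R}$, $\sigma>0$, $\delta=\mu/\sigma$, and let $1\le r<s\le n$. Let $X_{1:n}<\dots<X_{n:n}$ be the order statistics of a sample of size $n$ from the density $\frac1\sigma f\left(\frac{x-\mu}{\sigma}\right)$, and let $\boldsymbol X=(X_{1:n},\dots,X_{r:n})^\top$. Then the best linear invariant predictor $\hat X_{s:n}$ of $X_{s:n}$ based on $\boldsymbol X$, i.e. the predictor of the form $\boldsymbol a^\top\boldsymbol X$, $\boldsymbol a\in\mathbb{R}^r$, that minimizes the mean squared predictive error $E[(\boldsymbol a^\top\boldsymbol X-X_{s:n})^2]$ over $\boldsymbol a\in\mathbb{R}^r$, is $\hat X_{s:n}=\boldsymbol a^\top\boldsymbol X$ with $$\boldsymbol a=\boldsymbol\Gamma^{-1}\boldsymbol\Delta_s,$$ where $$\boldsymbol\Gamma=\boldsymbol\Sigma+(\boldsymbol\alpha+\delta\boldsymbol 1)(\boldsymbol\alpha+\delta\boldsymbol 1)^\top,\qquad \boldsymbol\Delta_s=\boldsymbol\omega_s+(\alpha_s+\delta)(\boldsymbol\alpha+\delta\boldsymbol 1).$$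
   Context: $f$ is a probability density on $\mathbb{R}$, and the sample consists of $n$ i.i.d. random variables with density $\frac1\sigma f\left(\frac{x-\mu}{\sigma}\right)$ (location-scale family). The standardized order statistics are $Z_{i:n}=(X_{i:n}-\mu)/\sigma$, $1\le i\le n$, assumed to have finite second moments. Notation: $\alpha_i=E[Z_{i:n}]$ for $1\le i\le n$; $\boldsymbol\alpha=(\alpha_1,\dots,\alpha_r)^\top$; $\boldsymbol 1=(1,\dots,1)^\top\in\mathbb{R}^r$; $\boldsymbol\Sigma$ is the $r\times r$ covariance matrix of $(Z_{1:n},\dots,Z_{r:n})^\top$, assumed positive definite; $\boldsymbol\omega_s=(\mathrm{Cov}(Z_{1:n},Z_{s:n}),\dots,\mathrm{Cov}(Z_{r:n},Z_{s:n}))^\top\in\mathbb{R}^r$. The minimization is for fixed $\mu,\sigma$, over all coefficient vectors in $\mathbb{R}^r$, with no unbiasedness constraint (the optimal coefficients depend on $\delta$). *)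

theory Defs
  imports
    "HOL-Probability.Probability"
    "Jordan_Normal_Form.Gauss_Jordan_Elimination"
begin

text \<open>The Jordan_Normal_Form vectors and matrices share this notation with HOL-Analysis.\<close>

unbundle no vec_syntax
unbundle no inner_syntax

text \<open>The sample is \<open>X 1, \<dots>, X n\<close>, and order statistics are numbered from 1, so position \<open>i\<close> of
  a vector (or row \<open>i\<close> of a matrix), counted from 0, belongs to the order statistic \<open>i + 1\<close>.\<close>

definition order_stat :: "(nat \<Rightarrow> 'a \<Rightarrow> real) \<Rightarrow> nat \<Rightarrow> nat \<Rightarrow> 'a \<Rightarrow> real" where
  "order_stat X n i \<omega> = sort (map (\<lambda>j. X j \<omega>) [1..<n + 1]) ! (i - 1)"

definition std_order_stat ::
  "(nat \<Rightarrow> 'a \<Rightarrow> real) \<Rightarrow> nat \<Rightarrow> real \<Rightarrow> real \<Rightarrow> nat \<Rightarrow> 'a \<Rightarrow> real" where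
  "std_order_stat X n \<mu> \<sigma> i \<omega> = (order_stat X n i \<omega> - \<mu>) / \<sigma>"

definition covariance :: "'a measure \<Rightarrow> ('a \<Rightarrow> real) \<Rightarrow> ('a \<Rightarrow> real) \<Rightarrow> real" where
  "covariance M Y Z =
    (\<integral>\<omega>. (Y \<omega> - (\<integral>\<eta>. Y \<eta> \<partial>M)) * (Z \<omega> - (\<integral>\<eta>. Z \<eta> \<partial>M)) \<partial>M)"

definition mean_vec :: "'a measure \<Rightarrow> (nat \<Rightarrow> 'a \<Rightarrow> real) \<Rightarrow> nat \<Rightarrow> real Matrix.vec" where
  "mean_vec M Z r = Matrix.vec r (\<lambda>i. \<integral>\<omega>. Z (i + 1) \<omega> \<partial>M)"

definition cov_mat :: "'a measure \<Rightarrow> (nat \<Rightarrow> 'a \<Rightarrow> real) \<Rightarrow> nat \<Rightarrow> real Matrix.mat" where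
  "cov_mat M Z r = Matrix.mat r r (\<lambda>(i, j). covariance M (Z (i + 1)) (Z (j + 1)))"

definition cov_vec :: "'a measure \<Rightarrow> (nat \<Rightarrow> 'a \<Rightarrow> real) \<Rightarrow> nat \<Rightarrow> nat \<Rightarrow> real Matrix.vec" where
  "cov_vec M Z r s = Matrix.vec r (\<lambda>i. covariance M (Z (i + 1)) (Z s))"

definition pos_def_mat :: "real Matrix.mat \<Rightarrow> bool" where
  "pos_def_mat A \<longleftrightarrow> square_mat A \<and> transpose_mat A = A \<and>
    (\<forall>v \<in> carrier_vec (dim_row A). v \<noteq> 0\<^sub>v (dim_row A) \<longrightarrow> v \<bullet> (A *\<^sub>v v) > 0)"

definition ones_vec :: "nat \<Rightarrow> real Matrix.vec" where
  "ones_vec r = Matrix.vec r (\<lambda>_. 1)"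

definition outer_prod :: "real Matrix.vec \<Rightarrow> real Matrix.vec \<Rightarrow> real Matrix.mat" where
  "outer_prod v w = Matrix.mat (dim_vec v) (dim_vec w) (\<lambda>(i, j). v $ i * w $ j)"

definition Gamma_mat :: "'a measure \<Rightarrow> (nat \<Rightarrow> 'a \<Rightarrow> real) \<Rightarrow> real \<Rightarrow> nat \<Rightarrow> real Matrix.mat" where
  "Gamma_mat M Z \<delta> r =
    cov_mat M Z r
      + outer_prod (mean_vec M Z r + \<delta> \<cdot>\<^sub>v ones_vec r) (mean_vec M Z r + \<delta> \<cdot>\<^sub>v ones_vec r)"

definition Delta_vec ::
  "'a measure \<Rightarrow> (nat \<Rightarrow> 'a \<Rightarrow> real) \<Rightarrow> real \<Rightarrow> nat \<Rightarrow> nat \<Rightarrow> real Matrix.vec" where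
  "Delta_vec M Z \<delta> r s =
    cov_vec M Z r s
      + ((\<integral>\<omega>. Z s \<omega> \<partial>M) + \<delta>) \<cdot>\<^sub>v (mean_vec M Z r + \<delta> \<cdot>\<^sub>v ones_vec r)"

definition linear_predictor ::
  "(nat \<Rightarrow> 'a \<Rightarrow> real) \<Rightarrow> nat \<Rightarrow> nat \<Rightarrow> real Matrix.vec \<Rightarrow> 'a \<Rightarrow> real" where
  "linear_predictor X n r a \<omega> = a \<bullet> Matrix.vec r (\<lambda>i. order_stat X n (i + 1) \<omega>)"

definition mspe :: "'a measure \<Rightarrow> (nat \<Rightarrow> 'a \<Rightarrow> real) \<Rightarrow> nat \<Rightarrow> nat \<Rightarrow> ('a \<Rightarrow> real) \<Rightarrow> real" where
  "mspe M X n s P = (\<integral>\<omega>. (P \<omega> - order_stat X n s \<omega>)\<^sup>2 \<partial>M)"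

text \<open>\<open>a\<close> is a coefficient vector of a best linear invariant predictor of the \<open>s\<close>-th order
  statistic from the first \<open>r\<close> ones.\<close>

definition blip_coeffs ::
  "'a measure \<Rightarrow> (nat \<Rightarrow> 'a \<Rightarrow> real) \<Rightarrow> nat \<Rightarrow> nat \<Rightarrow> nat \<Rightarrow> real Matrix.vec \<Rightarrow> bool" where
  "blip_coeffs M X n r s a \<longleftrightarrow> a \<in> carrier_vec r \<and>
    (\<forall>b \<in> carrier_vec r.
      mspe M X n s (linear_predictor X n r a) \<le> mspe M X n s (linear_predictor X n r b))"

end

theory Submission
  imports Defs "Jordan_Normal_Form.Determinant"
begin

text \<open>
  Since \<open>X\<^bsub>i:n\<^esub> = \<sigma> (Z\<^bsub>i:n\<^esub> + \<delta>)\<close>, the matrix \<open>\<Gamma>\<close> and the vector \<open>\<Delta>\<^sub>s\<close>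
  collect the uncentred second moments of the \<open>X\<^bsub>i:n\<^esub> / \<sigma>\<close>. Hence the mean squared predictive
  error of \<open>b\<close> is \<open>\<sigma>\<^sup>2 (b\<^sup>T \<Gamma> b - 2 b\<^sup>T \<Delta>\<^sub>s + c)\<close> with \<open>c\<close> independent of \<open>b\<close>. As a sum of a
  positive definite and a positive semidefinite matrix, \<open>\<Gamma>\<close> is positive definite, and completing
  the square shows that \<open>\<Gamma>\<^sup>-\<^sup>1 \<Delta>\<^sub>s\<close> is the unique minimizer.
\<close>

text \<open>Sorting keeps the number of entries at most \<open>t\<close> and moves them to an
  initial segment; position \<open>k\<close> lies in that segment exactly when it has more than
  \<open>k\<close> entries. This trades \<open>sort\<close> for a count.\<close>

lemma sort_nth_le_iff:
  fixes xs :: "'a::linorder list"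
  assumes "k < length xs"
  shows "sort xs ! k \<le> t \<longleftrightarrow> k < length (filter (\<lambda>x. x \<le> t) xs)"
proof -
  define ys where "ys = sort xs"
  have ys: "sorted ys" "k < length ys"
    using assms by (auto simp: ys_def)
  have "length (filter (\<lambda>x. x \<le> t) xs) = length (filter (\<lambda>x. x \<le> t) ys)"
    by (metis mset_filter mset_sort size_mset ys_def)
  also have "\<dots> = card {i. i < length ys \<and> ys ! i \<le> t}"
    by (rule length_filter_conv_card)
  finally have len: "length (filter (\<lambda>x. x \<le> t) xs) = card {i. i < length ys \<and> ys ! i \<le> t}" .
  show ?thesis
  proof (cases "ys ! k \<le> t")
    case True
    then have "{..k} \<subseteq> {i. i < length ys \<and> ys ! i \<le> t}"
      using ys by (auto intro: order_trans[OF sorted_nth_mono])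
    then have "card {..k} \<le> card {i. i < length ys \<and> ys ! i \<le> t}"
      by (intro card_mono) auto
    then show ?thesis using True len by (simp add: ys_def)
  next
    case False
    have "{i. i < length ys \<and> ys ! i \<le> t} \<subseteq> {..<k}"
    proof
      fix i assume i: "i \<in> {i. i < length ys \<and> ys ! i \<le> t}"
      show "i \<in> {..<k}"
      proof (rule ccontr)
        assume "i \<notin> {..<k}"
        then have "ys ! k \<le> ys ! i" using i ys by (intro sorted_nth_mono) auto
        then show False using i False by auto
      qed
    qed
    then have "card {i. i < length ys \<and> ys ! i \<le> t} \<le> card {..<k}"
      by (intro card_mono) auto
    then show ?thesis using False len by (simp add: ys_def)
  qed
qed

text \<open>The event that the order statistic is at most \<open>t\<close> says that at least
  \<open>i\<close> sample values are at most \<open>t\<close>, and that number is a finite sum of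
  measurable indicators.\<close>

lemma borel_measurable_order_stat:
  assumes X: "\<And>j. j \<in> {1..n} \<Longrightarrow> X j \<in> borel_measurable M" and i: "i \<in> {1..n}"
  shows "order_stat X n i \<in> borel_measurable M"
proof (subst borel_measurable_iff_le, rule allI)
  fix t :: real
  define N where "N \<omega> = (\<Sum>j\<in>{1..n}. if X j \<omega> \<le> t then 1 else (0::real))" for \<omega>
  have N: "N \<in> borel_measurable M"
    unfolding N_def using X by (intro borel_measurable_sum) measurable
  have count: "real (length (filter (\<lambda>x. x \<le> t) (map (\<lambda>j. X j \<omega>) [1..<n + 1]))) = N \<omega>" for \<omega>
  proof -
    have "length (filter (\<lambda>x. x \<le> t) (map (\<lambda>j. X j \<omega>) [1..<n + 1])) =
        card {j \<in> {1..n}. X j \<omega> \<le> t}"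
    proof -
      \<comment> \<open>Sample values may tie, so the count is taken over the indices, whose list is
        distinct.\<close>
      have "set (filter (\<lambda>j. X j \<omega> \<le> t) [1..<n + 1]) = {j \<in> {1..n}. X j \<omega> \<le> t}" by auto
      moreover have "distinct (filter (\<lambda>j. X j \<omega> \<le> t) [1..<n + 1])" by simp
      ultimately show ?thesis
        using distinct_card[of "filter (\<lambda>j. X j \<omega> \<le> t) [1..<n + 1]"]
        by (simp add: filter_map comp_def del: upt_Suc)
    qed
    then show ?thesis by (simp add: N_def sum.If_cases Int_def)
  qed
  \<comment> \<open>List positions start at 0, so \<open>i - 1 < N\<close> is the condition that at
    least \<open>i\<close> values count; \<open>i \<in> {1..n}\<close> keeps position
    \<open>i - 1\<close> inside the list.\<close>
  have "order_stat X n i \<omega> \<le> t \<longleftrightarrow> real (i - 1) < N \<omega>" for \<omega>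
    unfolding order_stat_def count[symmetric] of_nat_less_iff
    using i by (intro sort_nth_le_iff) auto
  then show "{\<omega> \<in> space M. order_stat X n i \<omega> \<le> t} \<in> sets M"
    using N by simp
qed

text \<open>Domination by \<open>f^2 + g^2\<close>, from \<open>2 * |u v| \<le> u^2 + v^2\<close>.
  It provides the mixed second moments of the order statistics.\<close>

lemma integrable_mult_of_square_integrable:
  fixes f g :: "'a \<Rightarrow> real"
  assumes [measurable]: "f \<in> borel_measurable M" "g \<in> borel_measurable M"
    and "integrable M (\<lambda>x. (f x)\<^sup>2)" "integrable M (\<lambda>x. (g x)\<^sup>2)"
  shows "integrable M (\<lambda>x. f x * g x)"
proof (rule Bochner_Integration.integrable_bound)
  show "integrable M (\<lambda>x. (f x)\<^sup>2 + (g x)\<^sup>2)" using assms by simp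
  have "\<bar>u * v\<bar> \<le> u\<^sup>2 + v\<^sup>2" for u v :: real
  proof -
    have "2 * \<bar>u * v\<bar> \<le> u\<^sup>2 + v\<^sup>2"
      using sum_squares_bound[of "\<bar>u\<bar>" "\<bar>v\<bar>"] by (simp add: abs_mult)
    then show ?thesis using abs_ge_zero[of "u * v"] by linarith
  qed
  then show "AE x in M. norm (f x * g x) \<le> norm ((f x)\<^sup>2 + (g x)\<^sup>2)"
    by simp
qed simp

text \<open>A common shift leaves the covariance alone and moves only the two means. With
  \<open>d = \<delta>\<close> the right-hand side has exactly the form of the entries of \<Gamma>
  and \<Delta>.\<close>

lemma (in prob_space) integral_shift_mult:
  assumes "integrable M Y" "integrable M Z" "integrable M (\<lambda>\<omega>. Y \<omega> * Z \<omega>)"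
  shows "(\<integral>\<omega>. (Y \<omega> + d) * (Z \<omega> + d) \<partial>M) =
    covariance M Y Z + (expectation Y + d) * (expectation Z + d)"
proof -
  have "covariance M Y Z = expectation (\<lambda>\<omega>. Y \<omega> * Z \<omega>) - expectation Y * expectation Z"
    unfolding covariance_def using assms by (simp add: algebra_simps prob_space)
  moreover have "(\<integral>\<omega>. (Y \<omega> + d) * (Z \<omega> + d) \<partial>M) =
      expectation (\<lambda>\<omega>. Y \<omega> * Z \<omega>) + d * expectation Y + d * expectation Z + d * d"
    using assms by (simp add: algebra_simps prob_space)
  ultimately show ?thesis by (simp add: algebra_simps)
qed

text \<open>The square is expanded pointwise and integrated term by term. The nested double sum is
  arranged to match a quadratic form \<open>b \<bullet> (A *\<^sub>v b)\<close> written out in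
  coordinates.\<close>

lemma integral_square_linear_error:
  fixes W :: "'i \<Rightarrow> 'a \<Rightarrow> real"
  assumes WW: "\<And>i j. i \<in> I \<Longrightarrow> j \<in> I \<Longrightarrow> integrable M (\<lambda>\<omega>. W i \<omega> * W j \<omega>)"
    and WV: "\<And>i. i \<in> I \<Longrightarrow> integrable M (\<lambda>\<omega>. W i \<omega> * V \<omega>)"
    and VV: "integrable M (\<lambda>\<omega>. (V \<omega>)\<^sup>2)"
  shows "(\<integral>\<omega>. ((\<Sum>i\<in>I. a i * W i \<omega>) - V \<omega>)\<^sup>2 \<partial>M) =
    (\<Sum>i\<in>I. a i * (\<Sum>j\<in>I. (\<integral>\<omega>. W i \<omega> * W j \<omega> \<partial>M) * a j))
      - 2 * (\<Sum>i\<in>I. a i * (\<integral>\<omega>. W i \<omega> * V \<omega> \<partial>M)) + (\<integral>\<omega>. (V \<omega>)\<^sup>2 \<partial>M)"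
proof -
  have "((\<Sum>i\<in>I. a i * W i \<omega>) - V \<omega>)\<^sup>2 =
      (\<Sum>i\<in>I. a i * (\<Sum>j\<in>I. (W i \<omega> * W j \<omega>) * a j))
        - 2 * (\<Sum>i\<in>I. a i * (W i \<omega> * V \<omega>)) + (V \<omega>)\<^sup>2" for \<omega>
  proof -
    have "(\<Sum>i\<in>I. a i * W i \<omega>)\<^sup>2 = (\<Sum>i\<in>I. a i * (\<Sum>j\<in>I. (W i \<omega> * W j \<omega>) * a j))"
      by (simp add: power2_eq_square sum_product sum_distrib_left mult_ac)
    moreover have "(\<Sum>i\<in>I. a i * W i \<omega>) * V \<omega> = (\<Sum>i\<in>I. a i * (W i \<omega> * V \<omega>))"
      unfolding sum_distrib_right by (simp add: mult_ac)
    ultimately show ?thesis by (simp add: power2_diff mult.assoc)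
  qed
  then show ?thesis using assms by simp
qed

lemma outer_prod_quadratic_form:
  assumes "u \<in> carrier_vec n" "v \<in> carrier_vec n"
  shows "v \<bullet> (outer_prod u u *\<^sub>v v) = (u \<bullet> v)\<^sup>2"
  using assms unfolding scalar_prod_def outer_prod_def
  by (simp add: scalar_prod_def power2_eq_square sum_product sum_distrib_left mult_ac)

text \<open>The rank-one term adds the square \<open>(u \<bullet> v)\<^sup>2\<close> to the
  quadratic form, so strict positivity survives.\<close>

lemma pos_def_mat_add_outer_prod:
  assumes A: "A \<in> carrier_mat n n" "pos_def_mat A" and u: "u \<in> carrier_vec n"
  shows "pos_def_mat (A + outer_prod u u)"
proof -
  have O: "outer_prod u u \<in> carrier_mat n n"
    using u by (auto simp: outer_prod_def)
  have "transpose_mat (outer_prod u u) = outer_prod u u"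
    by (auto simp: outer_prod_def mult.commute)
  then have "transpose_mat (A + outer_prod u u) = A + outer_prod u u"
    using A O transpose_add[OF A(1) O] by (simp add: pos_def_mat_def)
  moreover have "v \<bullet> ((A + outer_prod u u) *\<^sub>v v) > 0"
    if v: "v \<in> carrier_vec n" "v \<noteq> 0\<^sub>v n" for v
  proof -
    have "v \<bullet> ((A + outer_prod u u) *\<^sub>v v) = v \<bullet> (A *\<^sub>v v) + (u \<bullet> v)\<^sup>2"
      using A O u v
      by (simp add: add_mult_distrib_mat_vec[OF A(1) O v(1)] scalar_prod_add_distrib[of v n]
          outer_prod_quadratic_form)
    moreover have "v \<bullet> (A *\<^sub>v v) > 0"
      using A v by (auto simp: pos_def_mat_def)
    ultimately show ?thesis by (simp add: add_pos_nonneg)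
  qed
  ultimately show ?thesis using A O by (auto simp: pos_def_mat_def)
qed

text \<open>A nonzero kernel vector \<open>v\<close> would give
  \<open>v \<bullet> (A *\<^sub>v v) = 0\<close>, so the determinant cannot vanish.\<close>

lemma pos_def_mat_inverse:
  assumes A: "A \<in> carrier_mat n n" and "pos_def_mat A"
  obtains B where "mat_inverse A = Some B" "B \<in> carrier_mat n n" "A * B = 1\<^sub>m n"
proof -
  have "det A \<noteq> 0"
  proof
    assume "det A = 0"
    then obtain v where v: "v \<in> carrier_vec n" "v \<noteq> 0\<^sub>v n" "A *\<^sub>v v = 0\<^sub>v n"
      using det_0_iff_vec_prod_zero[OF A] by auto
    then have "v \<bullet> (A *\<^sub>v v) > 0" using assms by (auto simp: pos_def_mat_def)
    then show False using v by simp
  qed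
  \<comment> \<open>The value \<open>None\<close> would mean that \<open>A\<close> is not a unit of
    the matrix ring; \<open>()\<close> fills the dummy parameter of that ring structure.\<close>
  then have "mat_inverse A \<noteq> None"
    using mat_inverse(1)[OF A, of "()"] det_non_zero_imp_unit[OF A, of "()"] by blast
  then show ?thesis using mat_inverse(2)[OF A] that by auto
qed

text \<open>Since \<open>A *\<^sub>v a = d\<close>, the point \<open>a\<close> is critical for the
  quadratic function, so no linear term in \<open>b - a\<close> remains.\<close>

lemma quadratic_complete_square:
  assumes A: "A \<in> carrier_mat n n" "transpose_mat A = A"
    and a: "a \<in> carrier_vec n" "A *\<^sub>v a = d" and b: "b \<in> carrier_vec n"
  shows "b \<bullet> (A *\<^sub>v b) - 2 * (b \<bullet> d) =
    a \<bullet> (A *\<^sub>v a) - 2 * (a \<bullet> d) + (b - a) \<bullet> (A *\<^sub>v (b - a :: real Matrix.vec))"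
proof -
  have d: "d \<in> carrier_vec n" using A a by auto
  have Ab: "A *\<^sub>v b \<in> carrier_vec n" using A b by auto
  \<comment> \<open>Symmetry moves \<open>A\<close> onto \<open>a\<close>, so both cross terms of
    the expanded square equal \<open>b \<bullet> d\<close>.\<close>
  have "a \<bullet> (A *\<^sub>v b) = b \<bullet> d"
    using transpose_vec_mult_scalar[OF A(1) b a(1)] A a d b
    by (simp add: comm_scalar_prod[of _ n])
  then show ?thesis using A a b d Ab
    by (simp add: mult_minus_distrib_mat_vec[OF A(1)] minus_scalar_prod_distrib[of _ n]
        scalar_prod_minus_distrib[of _ n])
qed

text \<open>\<open>mat_inverse\<close> is option-valued, so the witness \<open>G\<close> also
  records that \<Gamma> is invertible. The equivalence expresses both optimality and uniqueness of
  the coefficient vector.\<close>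

theorem theorem1:
  fixes M :: "'a measure" and X :: "nat \<Rightarrow> 'a \<Rightarrow> real" and f :: "real \<Rightarrow> real"
    and \<mu> \<sigma> \<delta> :: real and n r s :: nat
  assumes "prob_space M"
    and "f \<in> borel_measurable borel" and "\<And>x. f x \<ge> 0"
    and "(\<integral>\<^sup>+x. ennreal (f x) \<partial>lborel) = 1"
    and "\<sigma> > 0" and "\<delta> = \<mu> / \<sigma>"
    and "1 \<le> r" and "r < s" and "s \<le> n"
    and "prob_space.indep_vars M (\<lambda>_. borel) X {1..n}"
    and "\<And>i. i \<in> {1..n} \<Longrightarrow>
      distributed M lborel (X i) (\<lambda>x. ennreal (1 / \<sigma> * f ((x - \<mu>) / \<sigma>)))"
    and "\<And>i. i \<in> {1..n} \<Longrightarrow> integrable M (\<lambda>\<omega>. (std_order_stat X n \<mu> \<sigma> i \<omega>)\<^sup>2)"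
    and "pos_def_mat (cov_mat M (std_order_stat X n \<mu> \<sigma>) r)"
  shows "\<exists>G. mat_inverse (Gamma_mat M (std_order_stat X n \<mu> \<sigma>) \<delta> r) = Some G \<and>
    (\<forall>a. blip_coeffs M X n r s a \<longleftrightarrow>
      a = G *\<^sub>v Delta_vec M (std_order_stat X n \<mu> \<sigma>) \<delta> r s)"
proof -
  interpret prob_space M by fact
  define Z where "Z = std_order_stat X n \<mu> \<sigma>"
  define W where "W i \<omega> = Z i \<omega> + \<delta>" for i \<omega>
  define \<Gamma> where "\<Gamma> = Gamma_mat M Z \<delta> r"
  define \<Delta> where "\<Delta> = Delta_vec M Z \<delta> r s"
  \<comment> \<open>Here \<mu> is absorbed into the shift \<delta> and \<sigma> becomes a common
    factor, which later leaves the integral as \<open>\<sigma>\<^sup>2\<close>.\<close>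
  have order_stat_eq: "order_stat X n i \<omega> = \<sigma> * W i \<omega>" for i \<omega>
    using \<open>\<sigma> > 0\<close> by (simp add: W_def Z_def std_order_stat_def \<open>\<delta> = \<mu> / \<sigma>\<close> field_simps)
  have "X i \<in> borel_measurable M" if "i \<in> {1..n}" for i
    using distributed_measurable[OF assms(11)[OF that]] by simp
  then have "order_stat X n i \<in> borel_measurable M" if "i \<in> {1..n}" for i
    using that by (intro borel_measurable_order_stat)
  then have Z_meas: "Z i \<in> borel_measurable M" if "i \<in> {1..n}" for i
    using that unfolding Z_def std_order_stat_def by measurable
  have Z_sq: "integrable M (\<lambda>\<omega>. (Z i \<omega>)\<^sup>2)" if "i \<in> {1..n}" for i
    using assms(12)[OF that] by (simp add: Z_def)
  have Z_int: "integrable M (Z i)" if "i \<in> {1..n}" for i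
    using that by (intro square_integrable_imp_integrable[OF Z_meas Z_sq])
  have ZZ_int: "integrable M (\<lambda>\<omega>. Z i \<omega> * Z j \<omega>)" if "i \<in> {1..n}" "j \<in> {1..n}" for i j
    using that by (intro integrable_mult_of_square_integrable Z_meas Z_sq)
  have W_int: "integrable M (\<lambda>\<omega>. W i \<omega> * W j \<omega>)" if "i \<in> {1..n}" "j \<in> {1..n}" for i j
    using that Z_int ZZ_int by (simp add: W_def algebra_simps)
  have W_moment: "(\<integral>\<omega>. W i \<omega> * W j \<omega> \<partial>M) =
      covariance M (Z i) (Z j) + (expectation (Z i) + \<delta>) * (expectation (Z j) + \<delta>)"
    if "i \<in> {1..n}" "j \<in> {1..n}" for i j
    unfolding W_def using that by (intro integral_shift_mult Z_int ZZ_int)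

  have \<Gamma>_carrier: "\<Gamma> \<in> carrier_mat r r" and \<Delta>_carrier: "\<Delta> \<in> carrier_vec r"
    by (auto simp: \<Gamma>_def \<Delta>_def Gamma_mat_def Delta_vec_def cov_mat_def cov_vec_def
        outer_prod_def mean_vec_def ones_vec_def)
  \<comment> \<open>Position \<open>i < r\<close> stands for order statistic \<open>i + 1\<close>,
    which lies in \<open>{1..n}\<close> because \<open>r < s \<le> n\<close>; hence
    \<open>W_moment\<close> applies.\<close>
  have \<Gamma>_nth: "\<Gamma> $$ (i, j) = (\<integral>\<omega>. W (i + 1) \<omega> * W (j + 1) \<omega> \<partial>M)" if "i < r" "j < r" for i j
    using that assms(8,9)
    by (simp add: W_moment \<Gamma>_def Gamma_mat_def cov_mat_def outer_prod_def mean_vec_def ones_vec_def)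
  have \<Delta>_nth: "\<Delta> $ i = (\<integral>\<omega>. W (i + 1) \<omega> * W s \<omega> \<partial>M)" if "i < r" for i
    using that assms(8,9)
    by (simp add: W_moment \<Delta>_def Delta_vec_def cov_vec_def mean_vec_def ones_vec_def)

  define c where "c = (\<integral>\<omega>. (W s \<omega>)\<^sup>2 \<partial>M)"
  have mspe_eq: "mspe M X n s (linear_predictor X n r b) =
      \<sigma>\<^sup>2 * (b \<bullet> (\<Gamma> *\<^sub>v b) - 2 * (b \<bullet> \<Delta>) + c)" if b: "b \<in> carrier_vec r" for b
  proof -
    have "mspe M X n s (linear_predictor X n r b) =
        (\<integral>\<omega>. \<sigma>\<^sup>2 * ((\<Sum>i<r. b $ i * W (i + 1) \<omega>) - W s \<omega>)\<^sup>2 \<partial>M)"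
      unfolding mspe_def linear_predictor_def order_stat_eq power_mult_distrib[symmetric]
      by (simp add: scalar_prod_def right_diff_distrib sum_distrib_left mult_ac
          lessThan_atLeast0)
    also have "\<dots> = \<sigma>\<^sup>2 * (\<integral>\<omega>. ((\<Sum>i<r. b $ i * W (i + 1) \<omega>) - W s \<omega>)\<^sup>2 \<partial>M)"
      by simp
    also have "(\<integral>\<omega>. ((\<Sum>i<r. b $ i * W (i + 1) \<omega>) - W s \<omega>)\<^sup>2 \<partial>M) =
        (\<Sum>i<r. b $ i * (\<Sum>j<r. (\<integral>\<omega>. W (i + 1) \<omega> * W (j + 1) \<omega> \<partial>M) * b $ j))
          - 2 * (\<Sum>i<r. b $ i * (\<integral>\<omega>. W (i + 1) \<omega> * W s \<omega> \<partial>M)) + c"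
      unfolding c_def using assms(8,9)
      by (intro integral_square_linear_error) (auto intro!: W_int simp: power2_eq_square)
    also have "\<dots> = b \<bullet> (\<Gamma> *\<^sub>v b) - 2 * (b \<bullet> \<Delta>) + c"
      using b \<Gamma>_carrier \<Delta>_carrier
      by (simp add: scalar_prod_def \<Gamma>_nth \<Delta>_nth lessThan_atLeast0)
    finally show ?thesis .
  qed

  have "pos_def_mat (cov_mat M Z r)" using assms(13) by (simp add: Z_def)
  then have \<Gamma>_pos: "pos_def_mat \<Gamma>"
    unfolding \<Gamma>_def Gamma_mat_def
    by (intro pos_def_mat_add_outer_prod[of _ r]) (auto simp: cov_mat_def mean_vec_def ones_vec_def)
  then obtain G where G: "mat_inverse \<Gamma> = Some G" "G \<in> carrier_mat r r" "\<Gamma> * G = 1\<^sub>m r"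
    using pos_def_mat_inverse[OF \<Gamma>_carrier] by blast
  define a\<^sub>0 where "a\<^sub>0 = G *\<^sub>v \<Delta>"
  have a0: "a\<^sub>0 \<in> carrier_vec r" using G(2) \<Delta>_carrier unfolding a\<^sub>0_def by (rule mult_mat_vec_carrier)
  \<comment> \<open>The normal equations of the least squares problem.\<close>
  have "\<Gamma> *\<^sub>v a\<^sub>0 = \<Delta>"
    unfolding a\<^sub>0_def using G \<Gamma>_carrier \<Delta>_carrier
    by (simp flip: assoc_mult_mat_vec[of \<Gamma> r r G r \<Delta>])
  then have complete_square: "b \<bullet> (\<Gamma> *\<^sub>v b) - 2 * (b \<bullet> \<Delta>) =
      a\<^sub>0 \<bullet> (\<Gamma> *\<^sub>v a\<^sub>0) - 2 * (a\<^sub>0 \<bullet> \<Delta>) + (b - a\<^sub>0) \<bullet> (\<Gamma> *\<^sub>v (b - a\<^sub>0))"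
    if "b \<in> carrier_vec r" for b
    using quadratic_complete_square[OF \<Gamma>_carrier _ a0 _ that] \<Gamma>_pos
    by (simp add: pos_def_mat_def)
  \<comment> \<open>The constant \<open>c\<close> is common to both errors, so the excess over the
    error of \<open>a\<^sub>0\<close> is a pure quadratic form in
    \<open>b - a\<^sub>0\<close>.\<close>
  have mspe_diff: "mspe M X n s (linear_predictor X n r b) =
      mspe M X n s (linear_predictor X n r a\<^sub>0) + \<sigma>\<^sup>2 * ((b - a\<^sub>0) \<bullet> (\<Gamma> *\<^sub>v (b - a\<^sub>0)))"
    if "b \<in> carrier_vec r" for b
    unfolding mspe_eq[OF that] mspe_eq[OF a0] complete_square[OF that]
    by (simp add: distrib_left)
  \<comment> \<open>Positive definiteness makes the excess strict away from
    \<open>a\<^sub>0\<close>; this single inequality gives both directions of the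
    equivalence.\<close>
  have less: "mspe M X n s (linear_predictor X n r a\<^sub>0) < mspe M X n s (linear_predictor X n r b)"
    if b: "b \<in> carrier_vec r" "b \<noteq> a\<^sub>0" for b
  proof -
    have "b - a\<^sub>0 \<noteq> 0\<^sub>v r"
    proof
      assume *: "b - a\<^sub>0 = 0\<^sub>v r"
      have "b $ i = a\<^sub>0 $ i" if "i < r" for i
        using arg_cong[OF *, of "\<lambda>v. v $ i"] that a0 by simp
      then show False using b a0 by (auto simp: Matrix.vec_eq_iff)
    qed
    then have "(b - a\<^sub>0) \<bullet> (\<Gamma> *\<^sub>v (b - a\<^sub>0)) > 0"
      using \<Gamma>_pos \<Gamma>_carrier b a0 by (auto simp: pos_def_mat_def)
    then show ?thesis using mspe_diff[OF b(1)] \<open>\<sigma> > 0\<close> by simp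
  qed
  have "blip_coeffs M X n r s a \<longleftrightarrow> a = a\<^sub>0" for a
  proof
    assume *: "blip_coeffs M X n r s a"
    show "a = a\<^sub>0"
    proof (rule ccontr)
      assume "a \<noteq> a\<^sub>0"
      with * a0 less[of a] show False by (auto simp: blip_coeffs_def not_less[symmetric])
    qed
  next
    assume "a = a\<^sub>0"
    with a0 less show "blip_coeffs M X n r s a"
      by (auto simp: blip_coeffs_def order_le_less)
  qed
  then show ?thesis
    using G(1) unfolding \<Gamma>_def a\<^sub>0_def \<Delta>_def Z_def by blast
qed

end
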